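(* Let $r\ge 2$ and $t\ge 1$ be integers, let $T$ be an $r$-tree with $(r-1)t+1$ vertices, and let $G$ be an $r$-graph that does not contain a copy of $T$. Then the chromatic number of $G$ is at most $2(r-1)(t-1)+1$.
   Context: An $r$-graph is a hypergraph all of whose edges have exactly $r$ vertices; containing a copy of $T$ means containing $T$ as a (not necessarily induced) subhypergraph. A cycle of length $t\ge 2$ in an $r$-graph consists of $t$ distinct vertices $x_1,\ldots,x_t$ and $t$ distinct edges $E_1,\ldots,E_t$ with $\{x_i,x_{i+1}\}\subseteq E_i$ for each $i$ (indices mod $t$). An $r$-forest is an $r$-graph with no cycles. An $r$-graph is connected if for every two vertices $x,y$ there are edges $E_1,\ldots,E_l$ with $x\in E_1$, $y\in E_l$ and $E_i\cap E_{i+1}\ne\emptyset$ for all $i$. An $r$-tree is a connected $r$-forest (so an $r$-tree with $(r-1)t+1$ vertices has $t$ edges). The chromatic number is the minimum number of colors in a vertex coloring with no monochromatic edge. *)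

theory Defs
  imports Main "HOL-Library.Extended_Nat"
begin

text \<open>Hypergraphs are not assumed to be finite.\<close>

record 'a hypergraph =
  verts :: "'a set"
  edges :: "'a set set"

definition r_graph :: "nat \<Rightarrow> 'a hypergraph \<Rightarrow> bool" where
  "r_graph r H \<longleftrightarrow> (\<forall>e\<in>edges H. e \<subseteq> verts H \<and> finite e \<and> card e = r)"

definition is_cycle :: "'a hypergraph \<Rightarrow> 'a list \<Rightarrow> 'a set list \<Rightarrow> bool" where
  "is_cycle H xs Es \<longleftrightarrow>
     length xs \<ge> 2 \<and> length Es = length xs \<and>
     distinct xs \<and> set xs \<subseteq> verts H \<and>
     distinct Es \<and> set Es \<subseteq> edges H \<and>
     (\<forall>i<length xs. {xs ! i, xs ! (Suc i mod length xs)} \<subseteq> Es ! i)"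

definition r_forest :: "nat \<Rightarrow> 'a hypergraph \<Rightarrow> bool" where
  "r_forest r H \<longleftrightarrow> r_graph r H \<and> (\<nexists>xs Es. is_cycle H xs Es)"

text \<open>Only distinct vertices have to be joined, so a single vertex without edges is connected.\<close>

definition hyper_connected :: "'a hypergraph \<Rightarrow> bool" where
  "hyper_connected H \<longleftrightarrow>
     (\<forall>x\<in>verts H. \<forall>y\<in>verts H. x \<noteq> y \<longrightarrow>
        (\<exists>Es. Es \<noteq> [] \<and> set Es \<subseteq> edges H \<and> x \<in> hd Es \<and> y \<in> last Es \<and>
              (\<forall>i. Suc i < length Es \<longrightarrow> Es ! i \<inter> Es ! Suc i \<noteq> {})))"

definition r_tree :: "nat \<Rightarrow> 'a hypergraph \<Rightarrow> bool" where
  "r_tree r H \<longleftrightarrow> r_forest r H \<and> hyper_connected H"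

definition contains_copy :: "'b hypergraph \<Rightarrow> 'a hypergraph \<Rightarrow> bool" where
  "contains_copy G T \<longleftrightarrow>
     (\<exists>f. inj_on f (verts T) \<and> f ` verts T \<subseteq> verts G \<and> (\<forall>e\<in>edges T. f ` e \<in> edges G))"

definition colorable :: "'a hypergraph \<Rightarrow> nat \<Rightarrow> bool" where
  "colorable H k \<longleftrightarrow>
     (\<exists>c. c ` verts H \<subseteq> {..<k} \<and> (\<forall>e\<in>edges H. \<not> (\<exists>i. \<forall>v\<in>e. c v = i)))"

text \<open>The value is \<open>\<infinity>\<close> if no finite number of colors suffices.\<close>

definition chromatic_number :: "'a hypergraph \<Rightarrow> enat" where
  "chromatic_number H = Inf (enat ` {k. colorable H k})"

end

theory Submission
  imports Defs
begin

text \<open>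
  Put \<open>k = (r - 1) * (t - 1) + 1\<close>; in fact \<open>k\<close> colors suffice. Otherwise, by compactness, some
  finite vertex set induces a hypergraph that is not \<open>k\<close>-colorable. Let \<open>W\<close> be a minimal one. For
  \<open>w \<in> W\<close>, a \<open>k\<close>-coloring of \<open>W - {w}\<close> extends to \<open>w\<close> in none of the \<open>k\<close> ways, so for each color
  there is an edge through \<open>w\<close> whose other vertices all have that color. These \<open>k\<close> edges meet
  pairwise in \<open>w\<close> only, hence any \<open>k - 1\<close> vertices other than \<open>w\<close> are avoided by one of them. So
  \<open>T\<close> can be embedded greedily, one edge at a time, each new edge meeting the part
  already embedded in a single vertex.
\<close>

section \<open>Induced subhypergraphs and monochromatic edges\<close>

definition induced :: "'a hypergraph \<Rightarrow> 'a set \<Rightarrow> 'a hypergraph" where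
  "induced H W = \<lparr>verts = W, edges = {e \<in> edges H. e \<subseteq> W}\<rparr>"

lemma induced_simps [simp]:
  "verts (induced H W) = W"
  "edges (induced H W) = {e \<in> edges H. e \<subseteq> W}"
  by (simp_all add: induced_def)

definition monochromatic :: "('a \<Rightarrow> nat) \<Rightarrow> 'a set \<Rightarrow> bool" where
  "monochromatic c e \<longleftrightarrow> (\<exists>i. \<forall>v\<in>e. c v = i)"

lemma monochromatic_cong: "(\<And>v. v \<in> e \<Longrightarrow> c v = d v) \<Longrightarrow> monochromatic c e \<longleftrightarrow> monochromatic d e"
  unfolding monochromatic_def by simp

lemma colorable_iff:
  "colorable H k \<longleftrightarrow> (\<exists>c. c ` verts H \<subseteq> {..<k} \<and> (\<forall>e\<in>edges H. \<not> monochromatic c e))"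
  unfolding colorable_def monochromatic_def ..

lemma chromatic_number_le:
  assumes "colorable H k"
  shows "chromatic_number H \<le> enat k"
  unfolding chromatic_number_def using assms by (auto intro: Inf_lower)


section \<open>Compactness\<close>

definition proper_on :: "'a hypergraph \<Rightarrow> nat \<Rightarrow> 'a set \<Rightarrow> ('a \<Rightarrow> nat) \<Rightarrow> bool" where
  "proper_on H k F c \<longleftrightarrow>
     c ` F \<subseteq> {..<k} \<and> (\<forall>e\<in>edges H. e \<subseteq> F \<longrightarrow> \<not> monochromatic c e)"

lemma proper_on_subset: "proper_on H k F c \<Longrightarrow> F' \<subseteq> F \<Longrightarrow> proper_on H k F' c"
  unfolding proper_on_def by blast

lemma colorable_induced_iff: "colorable (induced H F) k \<longleftrightarrow> (\<exists>c. proper_on H k F c)"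
  unfolding colorable_iff proper_on_def by (intro arg_cong[where f = Ex] ext) auto

text \<open>A partial coloring \<open>m\<close> is kept as a set of pairs, so that Zorn's lemma
  applies to inclusion. Finite extendability makes it single-valued on vertices: test it on
  \<open>{v}\<close>.\<close>

definition extendable_on :: "'a hypergraph \<Rightarrow> nat \<Rightarrow> ('a \<times> nat) set \<Rightarrow> 'a set \<Rightarrow> bool" where
  "extendable_on H k m F \<longleftrightarrow> (\<exists>c. proper_on H k F c \<and> (\<forall>v i. (v, i) \<in> m \<longrightarrow> v \<in> F \<longrightarrow> c v = i))"

definition finitely_extendable :: "'a hypergraph \<Rightarrow> nat \<Rightarrow> ('a \<times> nat) set \<Rightarrow> bool" where
  "finitely_extendable H k m \<longleftrightarrow>
     (\<forall>F. finite F \<longrightarrow> F \<subseteq> verts H \<longrightarrow> extendable_on H k m F)"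

text \<open>For finite \<open>F\<close> only the finitely many pairs in
  \<open>F \<times> {..<k}\<close> matter. Those in the union of the chain already lie in one
  member, and a coloring extending that member extends the union on \<open>F\<close>.\<close>

lemma finitely_extendable_Union:
  assumes chain: "subset.chain {m. finitely_extendable H k m \<and> m \<subseteq> verts H \<times> {..<k}} C"
    and "C \<noteq> {}"
  shows "finitely_extendable H k (\<Union>C)"
  unfolding finitely_extendable_def
proof (intro allI impI)
  fix F assume F: "finite F" "F \<subseteq> verts H"
  define D where "D = \<Union>C \<inter> F \<times> {..<k}"
  have sub: "m \<in> C \<Longrightarrow> finitely_extendable H k m \<and> m \<subseteq> verts H \<times> {..<k}" for m
    using chain by (auto simp: subset.chain_def)
  have "finite D" "D \<subseteq> \<Union>C"
    using F unfolding D_def by auto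
  then obtain m where m: "m \<in> C" "D \<subseteq> m"
    using finite_subset_Union_chain[OF _ _ \<open>C \<noteq> {}\<close> chain] by blast
  obtain c where c: "proper_on H k F c" "\<And>v i. (v, i) \<in> m \<Longrightarrow> v \<in> F \<Longrightarrow> c v = i"
    using sub[OF m(1)] F unfolding finitely_extendable_def extendable_on_def by auto
  have "c v = i" if vi: "(v, i) \<in> \<Union>C" "v \<in> F" for v i
  proof -
    have "(v, i) \<in> D"
      using sub vi unfolding D_def by auto
    then show ?thesis
      using m c(2) vi by auto
  qed
  with c(1) show "extendable_on H k (\<Union>C) F"
    unfolding extendable_on_def by auto
qed

text \<open>If each color \<open>i\<close> failed at \<open>v\<close> with a finite witness
  \<open>F i\<close>, take a coloring extending \<open>m\<close> on \<open>v\<close> and all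
  witnesses together. Its restriction to the witness of the color of \<open>v\<close> is a
  contradiction.\<close>

lemma finitely_extendable_insert:
  assumes ext: "finitely_extendable H k m" and v: "v \<in> verts H"
  shows "\<exists>i<k. finitely_extendable H k (insert (v, i) m)"
proof (rule ccontr)
  assume "\<not> ?thesis"
  then have "\<forall>i. \<exists>F. i < k \<longrightarrow> finite F \<and> F \<subseteq> verts H \<and> \<not> extendable_on H k (insert (v, i) m) F"
    unfolding finitely_extendable_def by meson
  then obtain F where F: "\<And>i. i < k \<Longrightarrow> finite (F i)" "\<And>i. i < k \<Longrightarrow> F i \<subseteq> verts H"
      "\<And>i. i < k \<Longrightarrow> \<not> extendable_on H k (insert (v, i) m) (F i)"
    by metis
  define F' where "F' = insert v (\<Union>i<k. F i)"
  have "finite F'" "F' \<subseteq> verts H"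
    using F(1,2) v unfolding F'_def by auto
  then obtain c where c: "proper_on H k F' c" "\<And>u j. (u, j) \<in> m \<Longrightarrow> u \<in> F' \<Longrightarrow> c u = j"
    using ext unfolding finitely_extendable_def extendable_on_def by metis
  have i: "c v < k"
    using c(1) unfolding F'_def proper_on_def by auto
  then have sub: "F (c v) \<subseteq> F'"
    unfolding F'_def by auto
  then have "proper_on H k (F (c v)) c"
    by (rule proper_on_subset[OF c(1)])
  then have "extendable_on H k (insert (v, c v) m) (F (c v))"
    unfolding extendable_on_def using c(2) sub by (intro exI[of _ c]) auto
  then show False
    using F(3)[OF i] by blast
qed

text \<open>The de Bruijn-Erdos argument: a maximal finitely extendable \<open>m\<close> assigns a
  color to every vertex, by the preceding lemma, and these colors form the required
  coloring.\<close>

lemma colorable_compact: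
  assumes edges: "\<And>e. e \<in> edges H \<Longrightarrow> finite e \<and> e \<subseteq> verts H"
    and fin: "\<And>F. finite F \<Longrightarrow> F \<subseteq> verts H \<Longrightarrow> colorable (induced H F) k"
  shows "colorable H k"
proof -
  let ?A = "{m. finitely_extendable H k m \<and> m \<subseteq> verts H \<times> {..<k}}"
  have "{} \<in> ?A"
    using fin unfolding finitely_extendable_def extendable_on_def colorable_induced_iff by auto
  moreover have "\<Union>C \<in> ?A" if "C \<noteq> {}" "subset.chain ?A C" for C
  proof -
    have "C \<subseteq> ?A"
      using that(2) unfolding subset.chain_def by (rule conjunct1)
    then have "\<Union>C \<subseteq> verts H \<times> {..<k}"
      by blast
    then show ?thesis
      using finitely_extendable_Union[OF that(2,1)] by simp
  qed
  ultimately have "\<exists>m\<in>?A. \<forall>m'\<in>?A. m \<subseteq> m' \<longrightarrow> m' = m"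
    by (intro subset_Zorn_nonempty) (rule ex_in_conv[THEN iffD1], rule exI)
  then obtain m where m: "m \<in> ?A" and max: "\<And>m'. m' \<in> ?A \<Longrightarrow> m \<subseteq> m' \<Longrightarrow> m' = m"
    by meson
  have "\<exists>i<k. (v, i) \<in> m" if v: "v \<in> verts H" for v
  proof -
    obtain i where i: "i < k" "finitely_extendable H k (insert (v, i) m)"
      using finitely_extendable_insert[of H k m v] v m by auto
    then have "insert (v, i) m = m"
      using m v by (intro max) auto
    then show ?thesis
      using i by auto
  qed
  then obtain c where c: "\<And>v. v \<in> verts H \<Longrightarrow> c v < k \<and> (v, c v) \<in> m"
    by metis
  have "\<not> monochromatic c e" if e: "e \<in> edges H" for e
  proof -
    \<comment> \<open>An edge is finite, hence an admissible test set. The coloring \<open>d\<close>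
      obtained from it agrees with \<open>c\<close> on \<open>e\<close>.\<close>
    have "extendable_on H k m e"
      using m edges[OF e] unfolding finitely_extendable_def by auto
    then obtain d where "\<not> monochromatic d e" "\<And>v i. (v, i) \<in> m \<Longrightarrow> v \<in> e \<Longrightarrow> d v = i"
      using e unfolding extendable_on_def proper_on_def by auto
    moreover have "\<forall>v\<in>e. (v, c v) \<in> m"
      using c edges[OF e] by auto
    ultimately show ?thesis
      by (metis monochromatic_cong)
  qed
  then show ?thesis
    unfolding colorable_iff using c by (intro exI[of _ c]) auto
qed


section \<open>Critical hypergraphs\<close>

text \<open>Compactness gives a finite non-colorable vertex set. One of least cardinality is
  critical, since deleting a vertex makes it smaller.\<close>

lemma obtain_minimal_not_colorable:
  assumes G: "r_graph r G" and "\<not> colorable G k"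
  obtains W where "finite W" "W \<subseteq> verts G" "\<not> colorable (induced G W) k"
    "\<And>w. w \<in> W \<Longrightarrow> colorable (induced G (W - {w})) k"
proof -
  obtain F where F: "finite F \<and> F \<subseteq> verts G \<and> \<not> colorable (induced G F) k"
    using colorable_compact[of G k] assms unfolding r_graph_def by blast
  then obtain W where W: "finite W \<and> W \<subseteq> verts G \<and> \<not> colorable (induced G W) k"
    and min: "\<And>V. finite V \<and> V \<subseteq> verts G \<and> \<not> colorable (induced G V) k \<Longrightarrow> card W \<le> card V"
    using ex_has_least_nat[of "\<lambda>W. finite W \<and> W \<subseteq> verts G \<and> \<not> colorable (induced G W) k" F card] by blast
  show ?thesis
  proof (rule that)
    show "colorable (induced G (W - {w})) k" if "w \<in> W" for w
      using min[of "W - {w}"] W that card_Diff1_less[of W w] by fastforce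
  qed (use W in auto)
qed

lemma critical_edge_avoiding:
  assumes G: "r_graph r G" and "r \<ge> 2"
    and W: "\<not> colorable (induced G W) k" and w: "colorable (induced G (W - {w})) k"
    and A: "finite A" "card A < k" "w \<notin> A" "A \<subseteq> W"
  obtains E where "E \<in> edges G" "E \<subseteq> W" "w \<in> E" "E \<inter> A = {}"
proof -
  obtain c where c: "c ` (W - {w}) \<subseteq> {..<k}"
      and proper: "\<And>e. e \<in> edges G \<Longrightarrow> e \<subseteq> W - {w} \<Longrightarrow> \<not> monochromatic c e"
    using w unfolding colorable_iff by auto
  have "card (c ` A) < card {..<k}"
    using A card_image_le[of A c] by simp
  then obtain i where i: "i < k" "i \<notin> c ` A"
    by (metis A(1) card_mono finite_imageI leD lessThan_iff subsetI)
  define d where "d = c(w := i)"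
  have "d ` W \<subseteq> {..<k}"
    using c i unfolding d_def by auto
  then obtain E j where E: "E \<in> edges G" "E \<subseteq> W" and j: "\<forall>v\<in>E. d v = j"
    using W unfolding colorable_iff monochromatic_def by force
  have "w \<in> E"
  proof (rule ccontr)
    assume "w \<notin> E"
    then have "E \<subseteq> W - {w}" "\<forall>v\<in>E. c v = j"
      using E j unfolding d_def by auto
    then show False
      using proper E unfolding monochromatic_def by blast
  qed
  \<comment> \<open>As \<open>w\<close> lies in \<open>E\<close> and has color \<open>i\<close>, the
    common color \<open>j\<close> is \<open>i\<close>.\<close>
  then have "\<forall>v\<in>E - {w}. c v = i"
    using j unfolding d_def by (metis DiffE fun_upd_apply singletonI)
  then have "E \<inter> A = {}"
    using i(2) A(3) by (metis disjoint_iff Diff_iff image_eqI singletonD)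
  then show ?thesis
    using that E \<open>w \<in> E\<close> by blast
qed


section \<open>Building a tree edge by edge\<close>

text \<open>An open analogue of \<open>is_cycle\<close>, with one more vertex than edges, so that
  one further edge can close it. Empty \<open>Es\<close> gives the trivial path.\<close>

definition hyper_path ::
    "'a set set \<Rightarrow> 'a set \<Rightarrow> 'a \<Rightarrow> 'a list \<Rightarrow> 'a set list \<Rightarrow> 'a \<Rightarrow> bool" where
  "hyper_path S U x xs Es y \<longleftrightarrow>
     distinct xs \<and> set xs \<subseteq> U \<and> distinct Es \<and> set Es \<subseteq> S \<and> length xs = Suc (length Es) \<and>
     xs ! 0 = x \<and> xs ! length Es = y \<and> (\<forall>i<length Es. {xs ! i, xs ! Suc i} \<subseteq> Es ! i)"

lemma hyper_path_rev:
  assumes "hyper_path S U x xs Es y"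
  shows "hyper_path S U y (rev xs) (rev Es) x"
proof -
  have "{rev xs ! i, rev xs ! Suc i} \<subseteq> rev Es ! i" if i: "i < length Es" for i
  proof -
    \<comment> \<open>Edge \<open>i\<close> of the reversed path is edge \<open>j\<close> of the
      original, traversed backwards.\<close>
    define j where "j = length Es - Suc i"
    have j: "j < length Es" "length Es - i = Suc j"
      using i unfolding j_def by auto
    have "{xs ! j, xs ! Suc j} \<subseteq> Es ! j"
      using assms j unfolding hyper_path_def by blast
    moreover have "rev xs ! i = xs ! Suc j" "rev xs ! Suc i = xs ! j" "rev Es ! i = Es ! j"
      using assms i j by (simp_all add: hyper_path_def rev_nth flip: j_def)
    ultimately show ?thesis
      by auto
  qed
  then show ?thesis
    using assms by (auto simp: hyper_path_def rev_nth)
qed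

lemma hyper_path_Cons:
  assumes "hyper_path S U x xs Es y" "v \<notin> U" "e \<notin> S" "v \<in> e" "x \<in> e"
  shows "hyper_path (insert e S) (U \<union> e) v (v # xs) (e # Es) y"
proof -
  have "{(v # xs) ! i, (v # xs) ! Suc i} \<subseteq> (e # Es) ! i" if "i < length (e # Es)" for i
    using assms that unfolding hyper_path_def by (cases i) auto
  then show ?thesis
    using assms unfolding hyper_path_def by auto
qed

text \<open>The edge chains in \<open>hyper_connected\<close> may repeat edges and name no vertices.
  Maintaining genuine paths while the tree grows avoids having to extract them from chains.\<close>

definition linked :: "'a set set \<Rightarrow> 'a set \<Rightarrow> bool" where
  "linked S U \<longleftrightarrow> (\<forall>x\<in>U. \<forall>y\<in>U. \<exists>xs Es. hyper_path S U x xs Es y)"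

lemma linked_singleton: "linked {} {x}"
  unfolding linked_def hyper_path_def by (intro ballI exI[of _ "[x]"] exI[of _ "[]"]) auto

text \<open>A new vertex reaches \<open>U\<close> through \<open>e\<close> and the attaching vertex
  \<open>z\<close>; two vertices of \<open>e\<close> are joined by \<open>e\<close> itself.\<close>

lemma linked_insert:
  assumes S: "linked S U" and e: "e \<notin> S" "e \<inter> U = {z}"
  shows "linked (insert e S) (U \<union> e)"
proof -
  have z: "z \<in> U" "z \<in> e"
    using e by auto
  have new: "\<exists>xs Es. hyper_path (insert e S) (U \<union> e) v xs Es y" if "v \<in> e - U" "y \<in> U" for v y
  proof -
    obtain xs Es where "hyper_path S U z xs Es y"
      using S z \<open>y \<in> U\<close> unfolding linked_def by blast
    then have "hyper_path (insert e S) (U \<union> e) v (v # xs) (e # Es) y"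
      using that z e by (intro hyper_path_Cons) auto
    then show ?thesis
      by blast
  qed
  have "\<exists>xs Es. hyper_path (insert e S) (U \<union> e) x xs Es y"
    if "x \<in> U \<union> e" "y \<in> U \<union> e" for x y
  proof -
    consider "x \<in> U" "y \<in> U" | "x \<in> e - U" "y \<in> U" | "x \<in> U" "y \<in> e - U"
      | "x = y" "x \<in> e" | "x \<in> e" "y \<in> e" "x \<noteq> y"
      using \<open>x \<in> U \<union> e\<close> \<open>y \<in> U \<union> e\<close> by blast
    then show ?thesis
    proof cases
      case 1
      then obtain xs Es where "hyper_path S U x xs Es y"
        using S unfolding linked_def by blast
      then have "hyper_path (insert e S) (U \<union> e) x xs Es y"
        unfolding hyper_path_def by auto
      then show ?thesis
        by blast
    next
      case 2
      then show ?thesis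
        by (rule new)
    next
      case 3
      then obtain xs Es where "hyper_path (insert e S) (U \<union> e) y xs Es x"
        using new by blast
      then have "hyper_path (insert e S) (U \<union> e) x (rev xs) (rev Es) y"
        by (rule hyper_path_rev)
      then show ?thesis
        by blast
    next
      case 4
      then have "hyper_path (insert e S) (U \<union> e) x [x] [] y"
        unfolding hyper_path_def by auto
      then show ?thesis
        by blast
    next
      case 5
      then have "hyper_path (insert e S) (U \<union> e) x [x, y] [e] y"
        unfolding hyper_path_def by auto
      then show ?thesis
        by blast
    qed
  qed
  then show ?thesis
    unfolding linked_def by blast
qed

lemma hyper_path_cycle:
  assumes path: "hyper_path S U x xs Es y" and "x \<noteq> y" "x \<in> e" "y \<in> e" "e \<notin> S"
    and "S \<subseteq> edges H" "e \<in> edges H" "U \<subseteq> verts H"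
  shows "is_cycle H xs (Es @ [e])"
proof -
  \<comment> \<open>This provides the two vertices that a cycle must have.\<close>
  have "Es \<noteq> []"
    using path \<open>x \<noteq> y\<close> unfolding hyper_path_def by auto
  have len: "length xs = Suc (length Es)"
    using path unfolding hyper_path_def by auto
  have "{xs ! i, xs ! (Suc i mod length xs)} \<subseteq> (Es @ [e]) ! i" if "i < length xs" for i
  proof (cases "i < length Es")
    case True
    then show ?thesis
      using path len unfolding hyper_path_def by (auto simp: nth_append)
  next
    case False
    \<comment> \<open>This last index belongs to \<open>y\<close>; its successor wraps around to
      \<open>x\<close>, and \<open>e\<close> contains both.\<close>
    then have "i = length Es"
      using that len by simp
    then show ?thesis
      using path len assms unfolding hyper_path_def by auto
  qed
  then show ?thesis
    using path assms \<open>Es \<noteq> []\<close> unfolding is_cycle_def hyper_path_def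
    by (auto simp: Suc_le_eq)
qed

text \<open>A chain of edges that starts in \<open>U\<close> cannot leave it: each edge meets its
  predecessor, which lies in \<open>U\<close>.\<close>

lemma hyper_connected_closed:
  assumes conn: "hyper_connected H" and "U \<noteq> {}" "U \<subseteq> verts H"
    and closed: "\<And>e. e \<in> edges H \<Longrightarrow> e \<inter> U \<noteq> {} \<Longrightarrow> e \<subseteq> U"
  shows "U = verts H"
proof (rule ccontr)
  assume "U \<noteq> verts H"
  then obtain x y where xy: "x \<in> U" "y \<in> verts H" "y \<notin> U"
    using assms by blast
  then obtain Es where Es: "Es \<noteq> []" "set Es \<subseteq> edges H" "x \<in> hd Es" "y \<in> last Es"
      "\<And>i. Suc i < length Es \<Longrightarrow> Es ! i \<inter> Es ! Suc i \<noteq> {}"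
    using conn assms unfolding hyper_connected_def by (metis subsetD)
  have "Es ! i \<subseteq> U" if "i < length Es" for i
    using that
  proof (induction i)
    case 0
    have "hd Es \<in> edges H" "hd Es \<inter> U \<noteq> {}"
      using Es(1-3) xy by auto
    then show ?case
      using closed Es(1) by (simp add: hd_conv_nth)
  next
    case (Suc i)
    then have "Es ! Suc i \<in> edges H" "Es ! Suc i \<inter> U \<noteq> {}"
      using Es(2) Es(5)[of i] by (auto simp: subset_eq)
    then show ?case
      by (rule closed)
  qed
  then have "last Es \<subseteq> U"
    using Es(1) by (simp add: last_conv_nth)
  then show False
    using Es xy by auto
qed

text \<open>Every finite tree grows from a vertex by attaching edges at single vertices. Take a
  largest edge set \<open>S\<close> so obtained. An edge outside \<open>S\<close> meeting
  \<open>U\<close> in two vertices would close a cycle, and one meeting it in a single vertex would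
  enlarge \<open>S\<close>. So \<open>U\<close> is closed under edges and is everything by
  connectedness.\<close>

lemma r_tree_induct [consumes 4, case_names base step]:
  assumes T: "r_tree r T" and "r > 0" and fin: "finite (verts T)" and x: "x \<in> verts T"
    and base: "P {} {x}"
    and step: "\<And>S U e z. \<lbrakk>e \<in> edges T; U \<subseteq> verts T; e \<inter> U = {z}; P S U\<rbrakk> \<Longrightarrow> P (insert e S) (U \<union> e)"
  shows "P (edges T) (verts T)"
proof -
  have T': "r_graph r T" "hyper_connected T" "\<not> is_cycle T xs Es" for xs Es
    using T unfolding r_tree_def r_forest_def by auto
  \<comment> \<open>The invariant carries \<open>linked\<close> to exclude cycles later;
    \<open>insert x\<close> covers the edgeless start.\<close>
  define Q where "Q S \<longleftrightarrow> S \<subseteq> edges T \<and> linked S (insert x (\<Union>S)) \<and> P S (insert x (\<Union>S))" for S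
  have "edges T \<subseteq> Pow (verts T)"
    using T' unfolding r_graph_def by auto
  then have fin_edges: "finite (edges T)"
    using fin finite_subset by blast
  have "Q {}"
    using base linked_singleton unfolding Q_def by auto
  moreover have "\<forall>S. Q S \<longrightarrow> card S < Suc (card (edges T))"
    using fin_edges by (auto simp: Q_def less_Suc_eq_le intro: card_mono)
  ultimately have "\<exists>S. Q S \<and> (\<forall>S'. Q S' \<longrightarrow> card S' \<le> card S)"
    by (rule ex_has_greatest_nat)
  then obtain S where S: "Q S" and max: "\<And>S'. Q S' \<Longrightarrow> card S' \<le> card S"
    by auto
  define U where "U = insert x (\<Union>S)"
  have U: "U \<subseteq> verts T" "U \<noteq> {}"
    using S x T' unfolding Q_def U_def r_graph_def by auto
  have in_S: "e \<in> S" if e: "e \<in> edges T" "e \<inter> U \<noteq> {}" for e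
  proof (rule ccontr)
    assume "e \<notin> S"
    obtain z where z: "z \<in> e" "z \<in> U"
      using e by auto
    have uniq: "y = z" if y: "y \<in> e" "y \<in> U" for y
    proof (rule ccontr)
      assume "y \<noteq> z"
      obtain xs Es where "hyper_path S U y xs Es z"
        using S y z unfolding Q_def U_def linked_def by blast
      then have "is_cycle T xs (Es @ [e])"
        using S U z y e \<open>y \<noteq> z\<close> \<open>e \<notin> S\<close> unfolding Q_def by (intro hyper_path_cycle[of S U y]) simp_all
      then show False
        using T' by blast
    qed
    have int: "e \<inter> U = {z}"
      using z by (auto dest: uniq)
    have eq: "insert x (\<Union>(insert e S)) = U \<union> e"
      unfolding U_def by auto
    have "P (insert e S) (U \<union> e)"
      using S U e int unfolding Q_def U_def by (intro step) auto
    moreover have "linked (insert e S) (U \<union> e)"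
      using S int \<open>e \<notin> S\<close> unfolding Q_def U_def by (intro linked_insert) auto
    ultimately have "Q (insert e S)"
      using S e unfolding Q_def eq by auto
    then have "card (insert e S) \<le> card S"
      by (rule max)
    moreover have "finite S"
      using S fin_edges finite_subset unfolding Q_def by blast
    ultimately show False
      using \<open>e \<notin> S\<close> by simp
  qed
  have "U = verts T"
    using in_S by (intro hyper_connected_closed[OF T'(2) U(2,1)]) (auto simp: U_def)
  moreover have "S = edges T"
  proof
    show "edges T \<subseteq> S"
    proof
      fix e assume e: "e \<in> edges T"
      \<comment> \<open>Nonemptiness, from \<open>r > 0\<close>, makes every edge meet
        \<open>U = verts T\<close>.\<close>
      then have "e \<subseteq> verts T" "e \<noteq> {}"
        using T'(1) \<open>r > 0\<close> unfolding r_graph_def by auto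
      then show "e \<in> S"
        using in_S e \<open>U = verts T\<close> by blast
    qed
  qed (use S Q_def in auto)
  ultimately show ?thesis
    using S unfolding Q_def U_def by auto
qed


section \<open>Greedy embedding\<close>

lemma extend_embedding:
  assumes inj: "inj_on f U" and e: "e \<inter> U = {z}" "finite e"
    and E: "finite E" "card E = card e" "E \<inter> f ` U = {f z}"
  obtains g where "inj_on g (U \<union> e)" "\<And>u. u \<in> U \<Longrightarrow> g u = f u" "g ` e = E"
proof -
  have mem: "z \<in> e" "z \<in> U" "f z \<in> E"
    using e E by auto
  have "card (e - {z}) = card (E - {f z})"
    using e E mem by simp
  then obtain h where h: "bij_betw h (e - {z}) (E - {f z})"
    using e E finite_same_card_bij[of "e - {z}" "E - {f z}"] by auto
  define g where "g v = (if v \<in> U then f v else h v)" for v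
  have "e - U = e - {z}"
    using e by auto
  have "bij_betw g (e - U) (E - {f z})"
    using h bij_betw_cong[of "e - U" g h] unfolding \<open>e - U = e - {z}\<close>[symmetric] g_def by simp
  then have g: "g ` (e - U) = E - {f z}" "inj_on g (e - U)"
    unfolding bij_betw_def by auto
  have gU: "g u = f u" if "u \<in> U" for u
    using that unfolding g_def by simp
  then have imU: "g ` U = f ` U" "inj_on g U"
    using inj by (auto simp: inj_on_def)
  have disj: "g ` U \<inter> g ` (e - U) = {}"
    using g imU E by auto
  have "inj_on g (U \<union> (e - U))"
    unfolding inj_on_Un using g imU disj by (auto simp: Diff_Diff_Int)
  moreover have "g ` e = E"
  proof -
    have "e = insert z (e - U)"
      using e by auto
    then have "g ` e = insert (g z) (g ` (e - U))"
      by (metis image_insert)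
    then show ?thesis
      using g gU mem by auto
  qed
  ultimately show ?thesis
    using that gU by simp
qed

text \<open>The bound in \<open>avoid\<close> is what one step needs: apart from the image of
  \<open>z\<close>, the embedded part together with the \<open>r\<close> vertices of the next edge
  fits into the vertex count of \<open>T\<close>.\<close>

lemma contains_copy_greedy:
  assumes T: "r_tree r T" "r > 0" "finite (verts T)" "verts T \<noteq> {}"
    and G: "r_graph r G" and W: "W \<noteq> {}" "W \<subseteq> verts G"
    and avoid: "\<And>w A. w \<in> W \<Longrightarrow> A \<subseteq> W - {w} \<Longrightarrow> finite A \<Longrightarrow> card A + r \<le> card (verts T) \<Longrightarrow>
      \<exists>E\<in>edges G. E \<subseteq> W \<and> w \<in> E \<and> E \<inter> A = {}"
  shows "contains_copy G T"
proof -
  obtain x w where x: "x \<in> verts T" and w: "w \<in> W"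
    using T W by blast
  have T': "r_graph r T"
    using T unfolding r_tree_def r_forest_def by auto
  \<comment> \<open>The last conjunct becomes \<open>\<Union>S \<subseteq> U\<close> during the
    induction, so extending \<open>f\<close> leaves the images of earlier edges unchanged.\<close>
  have "\<exists>f. inj_on f (verts T) \<and> f ` verts T \<subseteq> W \<and> (\<forall>e\<in>edges T. f ` e \<in> edges G) \<and> \<Union>(edges T) \<subseteq> verts T"
    using T(1-3) x
  proof (induction rule: r_tree_induct)
    case base
    show ?case
      using w by (intro exI[of _ "\<lambda>_. w"]) auto
  next
    case (step S U e z)
    then obtain f where f: "inj_on f U" "f ` U \<subseteq> W" "\<forall>e\<in>S. f ` e \<in> edges G" and SU: "\<Union>S \<subseteq> U"
      by blast
    have e: "finite e" "card e = r" "e \<subseteq> verts T"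
      using T' step unfolding r_graph_def by auto
    have z: "z \<in> e" "z \<in> U"
      using step by auto
    have "finite U"
      using step T finite_subset by blast
    \<comment> \<open>The vertices already used, except \<open>f z\<close>, at which the new edge
      must attach.\<close>
    define A where "A = f ` (U - {z})"
    have "A \<subseteq> W - {f z}" "finite A"
      using f z \<open>finite U\<close> unfolding A_def inj_on_def by auto
    moreover have "card A + r \<le> card (verts T)"
    proof -
      have "card A \<le> card (U - {z})"
        unfolding A_def using \<open>finite U\<close> by (intro card_image_le) auto
      moreover have "card ((U - {z}) \<union> e) = card (U - {z}) + card e"
        using \<open>finite U\<close> e step by (intro card_Un_disjoint) auto
      moreover have "card ((U - {z}) \<union> e) \<le> card (verts T)"
        using step e T by (intro card_mono) auto
      ultimately show ?thesis
        using e by simp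
    qed
    ultimately obtain E where E: "E \<in> edges G" "E \<subseteq> W" "f z \<in> E" "E \<inter> A = {}"
      using avoid[of "f z" A] f z by blast
    have "E \<inter> f ` U = {f z}"
      using E z unfolding A_def by auto
    moreover have "finite E" "card E = card e"
      using E G e unfolding r_graph_def by auto
    ultimately obtain g where g: "inj_on g (U \<union> e)" "\<And>u. u \<in> U \<Longrightarrow> g u = f u" "g ` e = E"
      using extend_embedding[of f U e z E] f step e by blast
    have "g ` d = f ` d" if "d \<in> S" for d
      using g(2) SU that by (intro image_cong) auto
    then have "\<forall>d\<in>insert e S. g ` d \<in> edges G"
      using f g(3) E by auto
    moreover have "g ` (U \<union> e) \<subseteq> W"
      using f g E by (auto simp: image_Un)
    ultimately show ?case
      using g(1) SU by (intro exI[of _ g]) auto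
  qed
  then obtain f where "inj_on f (verts T)" "f ` verts T \<subseteq> W" "\<forall>e\<in>edges T. f ` e \<in> edges G"
    by blast
  then show ?thesis
    unfolding contains_copy_def using W(2) by (intro exI[of _ f]) auto
qed

theorem theorem7:
  fixes r t :: nat
    and T :: "'a hypergraph"
    and G :: "'b hypergraph"
  assumes "r \<ge> 2" and "t \<ge> 1"
    and "r_tree r T" and "card (verts T) = (r - 1) * t + 1"
    and "r_graph r G" and "\<not> contains_copy G T"
  shows "chromatic_number G \<le> enat (2 * (r - 1) * (t - 1) + 1)"
proof -
  define k where "k = (r - 1) * (t - 1) + 1"
  have card_T: "card (verts T) = k + (r - 1)"
    using assms(1,2,4) unfolding k_def by (cases t) auto
  then have T: "finite (verts T)" "verts T \<noteq> {}"
    using assms(1) by (auto intro: card_ge_0_finite)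
  have "colorable G k"
  proof (rule ccontr)
    assume "\<not> colorable G k"
    then obtain W where W: "finite W" "W \<subseteq> verts G" "\<not> colorable (induced G W) k"
        "\<And>w. w \<in> W \<Longrightarrow> colorable (induced G (W - {w})) k"
      using obtain_minimal_not_colorable assms(5) by metis
    have "contains_copy G T"
    proof (rule contains_copy_greedy[OF assms(3) _ T assms(5) _ W(2)])
      \<comment> \<open>With no empty edge, the empty vertex set induces no edge and is colorable,
        so \<open>W\<close> is not empty.\<close>
      have "e \<noteq> {}" if "e \<in> edges G" for e
        using assms(1,5) that unfolding r_graph_def by auto
      then have "colorable (induced G {}) k"
        unfolding colorable_iff by auto
      then show "W \<noteq> {}"
        using W(3) by auto
      show "\<exists>E\<in>edges G. E \<subseteq> W \<and> w \<in> E \<and> E \<inter> A = {}"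
        if w: "w \<in> W" and A: "A \<subseteq> W - {w}" "finite A" "card A + r \<le> card (verts T)" for w A
      proof -
        \<comment> \<open>Here \<open>card (verts T) = k + r - 1\<close>, so exactly the sets of
          fewer than \<open>k\<close> vertices have to be avoided.\<close>
        have "card A < k"
          using A(3) card_T assms(1) by simp
        moreover have "w \<notin> A" "A \<subseteq> W"
          using A by auto
        ultimately obtain E where "E \<in> edges G" "E \<subseteq> W" "w \<in> E" "E \<inter> A = {}"
          using critical_edge_avoiding[OF assms(5,1) W(3) W(4)[OF w] A(2)] by metis
        then show ?thesis
          by blast
      qed
    qed (use assms(1) in simp)
    then show False
      using assms by simp
  qed
  then have "chromatic_number G \<le> enat k"
    by (rule chromatic_number_le)
  \<comment> \<open>The stated bound has an additional factor 2.\<close>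
  also have "\<dots> \<le> enat (2 * (r - 1) * (t - 1) + 1)"
    unfolding k_def by simp
  finally show ?thesis .
qed

end
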